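(* There are pseudovarieties of semigroups, consisting of finite nil semigroups, that have finite rank and are infinitely based.
   Context: A pseudovariety of semigroups is a class of finite semigroups closed under homomorphic images, subsemigroups and finitary direct products. A finite semigroup is nil if it has a zero and every element has some power equal to the zero. A semigroup $S$ is $n$-generated if it is generated by some subset of $S$ with at most $n$ elements. A pseudovariety $\mathsf{V}$ has rank at most $n$ if, whenever a finite semigroup $S$ is such that all its $n$-generated subsemigroups belong to $\mathsf{V}$, so does $S$. $\mathsf{V}$ has finite rank if there is an integer $n\geq 0$ such that $\mathsf{V}$ has rank at most $n$. A pseudoidentity is a formal equality $u=v$ of two elements of the free profinite semigroup on some finite set $\{x_1,\ldots,x_n\}$ of variables; a finite semigroup $S$ satisfies it if $\varphi(u)=\varphi(v)$ for every continuous homomorphism $\varphi$ from that free profinite semigroup to $S$ (with $S$ discrete). A basis of a pseudovariety $\mathsf{V}$ is a set of pseudoidentities such that $\mathsf{V}$ consists of exactly the finite semigroups satisfying all of them. $\mathsf{V}$ is finitely based if it has a finite basis of pseudoidentities, and infinitely based otherwise. *)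

theory Defs
  imports "HOL-Analysis.Analysis"
begin

section \<open>Semigroups with an explicit carrier\<close>

record 'a sgrp =
  elems :: "'a set"
  mul :: "'a \<Rightarrow> 'a \<Rightarrow> 'a"

text \<open>Semigroups are nonempty. The values of \<^term>\<open>mul S\<close> outside the carrier are irrelevant.\<close>

definition semigrp :: "'a sgrp \<Rightarrow> bool" where
  "semigrp S \<longleftrightarrow> elems S \<noteq> {} \<and>
     (\<forall>x\<in>elems S. \<forall>y\<in>elems S. mul S x y \<in> elems S) \<and>
     (\<forall>x\<in>elems S. \<forall>y\<in>elems S. \<forall>z\<in>elems S. mul S (mul S x y) z = mul S x (mul S y z))"

definition fin_semigrp :: "'a sgrp \<Rightarrow> bool" where
  "fin_semigrp S \<longleftrightarrow> semigrp S \<and> finite (elems S)"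

definition sgrp_hom :: "'a sgrp \<Rightarrow> 'b sgrp \<Rightarrow> ('a \<Rightarrow> 'b) set" where
  "sgrp_hom S T = {h. h ` elems S \<subseteq> elems T \<and>
     (\<forall>x\<in>elems S. \<forall>y\<in>elems S. h (mul S x y) = mul T (h x) (h y))}"

definition sgrp_iso :: "'a sgrp \<Rightarrow> 'b sgrp \<Rightarrow> ('a \<Rightarrow> 'b) set" where
  "sgrp_iso S T = {h \<in> sgrp_hom S T. bij_betw h (elems S) (elems T)}"

definition sub_sgrp :: "'a sgrp \<Rightarrow> 'a sgrp \<Rightarrow> bool" where
  "sub_sgrp T S \<longleftrightarrow> semigrp T \<and> elems T \<subseteq> elems S \<and> mul T = mul S"

definition prod_sgrp :: "'i set \<Rightarrow> ('i \<Rightarrow> 'a sgrp) \<Rightarrow> ('i \<Rightarrow> 'a) sgrp" where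
  "prod_sgrp I S = \<lparr>elems = (\<Pi>\<^sub>E i\<in>I. elems (S i)), mul = (\<lambda>f g. \<lambda>i\<in>I. mul (S i) (f i) (g i))\<rparr>"

inductive_set sgrp_span :: "'a sgrp \<Rightarrow> 'a set \<Rightarrow> 'a set" for S A where
  base: "a \<in> A \<Longrightarrow> a \<in> sgrp_span S A"
| mult: "a \<in> sgrp_span S A \<Longrightarrow> b \<in> sgrp_span S A \<Longrightarrow> mul S a b \<in> sgrp_span S A"

definition n_generated :: "nat \<Rightarrow> 'a sgrp \<Rightarrow> bool" where
  "n_generated n S \<longleftrightarrow>
     (\<exists>A. A \<subseteq> elems S \<and> finite A \<and> card A \<le> n \<and> sgrp_span S A = elems S)"

text \<open>\<open>sgrp_pow S x k\<close> is the power of \<open>x\<close> with exponent \<open>k + 1\<close>.\<close>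

primrec sgrp_pow :: "'a sgrp \<Rightarrow> 'a \<Rightarrow> nat \<Rightarrow> 'a" where
  "sgrp_pow S x 0 = x"
| "sgrp_pow S x (Suc k) = mul S (sgrp_pow S x k) x"

definition nil_sgrp :: "'a sgrp \<Rightarrow> bool" where
  "nil_sgrp S \<longleftrightarrow> (\<exists>z\<in>elems S. (\<forall>x\<in>elems S. mul S z x = z \<and> mul S x z = z) \<and>
     (\<forall>x\<in>elems S. \<exists>k. sgrp_pow S x k = z))"

section \<open>Pseudovarieties\<close>

text \<open>
  Every finite semigroup is isomorphic to one whose carrier is a set of natural numbers, so an
  isomorphism-closed class of finite semigroups is represented by its members of type
  \<^typ>\<open>nat sgrp\<close>. A product of members does not have this type; closure under finitary products
  therefore refers to all isomorphic copies of the product. The index set may be empty, so that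
  a pseudovariety contains the trivial semigroups and is nonempty.
\<close>

definition pseudovariety :: "nat sgrp set \<Rightarrow> bool" where
  "pseudovariety V \<longleftrightarrow>
     (\<forall>S\<in>V. fin_semigrp S) \<and>
     (\<forall>S\<in>V. \<forall>T h. fin_semigrp T \<and> h \<in> sgrp_hom S T \<and> h ` elems S = elems T \<longrightarrow> T \<in> V) \<and>
     (\<forall>S\<in>V. \<forall>T. sub_sgrp T S \<longrightarrow> T \<in> V) \<and>
     (\<forall>(I :: nat set) S T h. finite I \<and> (\<forall>i\<in>I. S i \<in> V) \<and> fin_semigrp T \<and>
        h \<in> sgrp_iso (prod_sgrp I S) T \<longrightarrow> T \<in> V)"

definition rank_at_most :: "nat sgrp set \<Rightarrow> nat \<Rightarrow> bool" where
  "rank_at_most V n \<longleftrightarrow>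
     (\<forall>S. fin_semigrp S \<and> (\<forall>T. sub_sgrp T S \<and> n_generated n T \<longrightarrow> T \<in> V) \<longrightarrow> S \<in> V)"

definition finite_rank :: "nat sgrp set \<Rightarrow> bool" where
  "finite_rank V \<longleftrightarrow> (\<exists>n. rank_at_most V n)"

section \<open>Free profinite semigroups and pseudoidentities\<close>

text \<open>
  The free profinite semigroup on \<open>n\<close> variables is the inverse limit of the finite quotients of
  the free semigroup of nonempty words over \<^term>\<open>{..<n}\<close>: an element is a compatible
  choice of a class modulo every congruence of finite index. The variable \<open>i\<close> is the family of the
  classes of the word \<^term>\<open>[i]\<close>.
\<close>

definition nwords :: "nat \<Rightarrow> nat list set" where
  "nwords n = lists {..<n} - {[]}"

definition fin_congs :: "nat \<Rightarrow> nat list rel set" where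
  "fin_congs n = {r. equiv (nwords n) r \<and> finite (nwords n // r) \<and>
     (\<forall>(a, b)\<in>r. \<forall>(c, d)\<in>r. (a @ c, b @ d) \<in> r)}"

type_synonym pro_word = "nat list rel \<Rightarrow> nat list set"

text \<open>The product of two classes modulo \<open>r\<close> is the class of all concatenations of their members.\<close>

definition free_profinite :: "nat \<Rightarrow> pro_word sgrp" where
  "free_profinite n =
     \<lparr>elems = {u \<in> \<Pi>\<^sub>E r\<in>fin_congs n. nwords n // r.
                 \<forall>r\<in>fin_congs n. \<forall>s\<in>fin_congs n. r \<subseteq> s \<longrightarrow> u r \<subseteq> u s},
      mul = (\<lambda>u v. \<lambda>r\<in>fin_congs n. r `` {a @ b | a b. a \<in> u r \<and> b \<in> v r})\<rparr>"

definition profinite_topology :: "nat \<Rightarrow> pro_word topology" where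
  "profinite_topology n =
     subtopology (product_topology (\<lambda>r. discrete_topology (nwords n // r)) (fin_congs n))
       (elems (free_profinite n))"

definition cont_homs :: "nat \<Rightarrow> 'a sgrp \<Rightarrow> (pro_word \<Rightarrow> 'a) set" where
  "cont_homs n S = {\<phi> \<in> sgrp_hom (free_profinite n) S.
     continuous_map (profinite_topology n) (discrete_topology (elems S)) \<phi>}"

text \<open>The triple \<open>(n, u, v)\<close> stands for the formal equality of \<open>u\<close> and \<open>v\<close> over \<open>n\<close> variables.\<close>

type_synonym pseudoidentity = "nat \<times> pro_word \<times> pro_word"

definition pseudoidentities :: "pseudoidentity set" where
  "pseudoidentities =
     {(n, u, v). u \<in> elems (free_profinite n) \<and> v \<in> elems (free_profinite n)}"

definition satisfies :: "'a sgrp \<Rightarrow> pseudoidentity \<Rightarrow> bool" where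
  "satisfies S e \<longleftrightarrow> (case e of (n, u, v) \<Rightarrow> \<forall>\<phi>\<in>cont_homs n S. \<phi> u = \<phi> v)"

definition is_basis :: "nat sgrp set \<Rightarrow> pseudoidentity set \<Rightarrow> bool" where
  "is_basis V E \<longleftrightarrow> E \<subseteq> pseudoidentities \<and> V = {S. fin_semigrp S \<and> (\<forall>e\<in>E. satisfies S e)}"

definition finitely_based :: "nat sgrp set \<Rightarrow> bool" where
  "finitely_based V \<longleftrightarrow> (\<exists>E. finite E \<and> is_basis V E)"

definition infinitely_based :: "nat sgrp set \<Rightarrow> bool" where
  "infinitely_based V \<longleftrightarrow> \<not> finitely_based V"

end

theory Submission
  imports Defs "HOL-Library.Sublist" "HOL-Computational_Algebra.Primes"
begin

text \<open>
  Take the nil semigroups satisfying \<open>x y\<^sup>p x = x x y\<^sup>p\<close> for all primes \<open>p\<close>. Both being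
  nil and the laws involve at most two elements at a time, so the rank is at most 2.

  The Rees quotient of the semigroup of words consisting of the factors of \<open>a b\<^sup>p a\<close> violates the
  law for \<open>p\<close> but satisfies it for every prime \<open>q \<noteq> p\<close>: an instance of a side of the law for \<open>q\<close>
  that is a factor of \<open>a b\<^sup>p a\<close> involves only powers of \<open>b\<close>, which commute. So no finitely many of
  these laws define the pseudovariety.

  To pass to arbitrary pseudoidentities \<open>u = v\<close>: if neither \<open>u\<close> nor \<open>v\<close> is a finite word, every
  finite nilpotent semigroup satisfies it. If one of them is a word of length less than \<open>N\<close>, then
  \<open>S\<close> satisfies \<open>u = v\<close> as soon as the truncation of \<open>S \<times> {1, 2, \<dots>}\<close>, in which everything of second
  component at least \<open>N\<close> is zero, does; and this truncation satisfies the laws for all primes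
  \<open>p \<ge> N\<close>, both sides being zero. Hence a finite basis would follow from the laws for the primes
  below some bound.
\<close>

section \<open>Words and their values in a semigroup\<close>

text \<open>The one-letter case is the base, since a semigroup has no unit that could be the value
  of the empty word.\<close>

fun weval :: "'a sgrp \<Rightarrow> (nat \<Rightarrow> 'a) \<Rightarrow> nat list \<Rightarrow> 'a" where
  "weval S f [] = undefined"
| "weval S f [x] = f x"
| "weval S f (x # y # ys) = mul S (f x) (weval S f (y # ys))"

lemma weval_Cons: "a \<noteq> [] \<Longrightarrow> weval S f (x # a) = mul S (f x) (weval S f a)"
  by (cases a) auto

lemma nwords_iff: "a \<in> nwords n \<longleftrightarrow> a \<noteq> [] \<and> set a \<subseteq> {..<n}"
  by (auto simp: nwords_def)

lemma nwords_append: "a \<in> nwords n \<Longrightarrow> b \<in> nwords n \<Longrightarrow> a @ b \<in> nwords n"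
  by (auto simp: nwords_iff)

lemma nwords_induct [consumes 1, case_names single Cons]:
  assumes "a \<in> nwords n"
    and "\<And>x. x < n \<Longrightarrow> P [x]"
    and "\<And>x a. x < n \<Longrightarrow> a \<in> nwords n \<Longrightarrow> P a \<Longrightarrow> P (x # a)"
  shows "P a"
  using assms(1)
proof (induction a)
  case Nil
  then show ?case by (simp add: nwords_iff)
next
  case (Cons x a)
  then show ?case using assms(2,3) by (cases "a = []") (auto simp: nwords_iff)
qed

lemma semigrp_mul: "semigrp S \<Longrightarrow> x \<in> elems S \<Longrightarrow> y \<in> elems S \<Longrightarrow> mul S x y \<in> elems S"
  by (auto simp: semigrp_def)

lemma semigrp_assoc:
  "semigrp S \<Longrightarrow> x \<in> elems S \<Longrightarrow> y \<in> elems S \<Longrightarrow> z \<in> elems S \<Longrightarrow>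
    mul S (mul S x y) z = mul S x (mul S y z)"
  by (auto simp: semigrp_def)

lemma weval_in:
  assumes "semigrp S" "f \<in> {..<n} \<rightarrow> elems S" "a \<in> nwords n"
  shows "weval S f a \<in> elems S"
  using assms(3)
  by (induction rule: nwords_induct) (use assms in \<open>auto simp: weval_Cons nwords_iff intro!: semigrp_mul\<close>)

lemma weval_append:
  assumes "semigrp S" "f \<in> {..<n} \<rightarrow> elems S" "a \<in> nwords n" "b \<in> nwords n"
  shows "weval S f (a @ b) = mul S (weval S f a) (weval S f b)"
  using assms(3)
proof (induction rule: nwords_induct)
  case (single x)
  then show ?case using assms(4) by (simp add: weval_Cons nwords_iff)
next
  case (Cons x a)
  moreover have "f x \<in> elems S" "weval S f a \<in> elems S" "weval S f b \<in> elems S"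
    using Cons assms weval_in[OF assms(1,2)] by auto
  ultimately show ?case
    using assms by (simp add: weval_Cons nwords_iff semigrp_assoc)
qed

section \<open>Congruences of finite index and continuous homomorphisms\<close>

text \<open>The kernel of the homomorphism from the free semigroup to \<open>S\<close> that extends
  \<open>f\<close>. A profinite word \<open>u\<close> gets its value at \<open>f\<close> from any
  finite word in the class \<open>u (wker n S f)\<close>.\<close>

definition wker :: "nat \<Rightarrow> 'a sgrp \<Rightarrow> (nat \<Rightarrow> 'a) \<Rightarrow> nat list rel" where
  "wker n S f = {(a, b). a \<in> nwords n \<and> b \<in> nwords n \<and> weval S f a = weval S f b}"

lemma wker_fin_congs:
  assumes "fin_semigrp S" "f \<in> {..<n} \<rightarrow> elems S"
  shows "wker n S f \<in> fin_congs n"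
proof -
  have S: "semigrp S" "finite (elems S)" using assms(1) by (auto simp: fin_semigrp_def)
  have "equiv (nwords n) (wker n S f)"
    by (auto simp: wker_def equiv_def refl_on_def sym_def trans_def)
  \<comment> \<open>Each class is a fibre of \<open>weval S f\<close> over an element of the finite
    semigroup \<open>S\<close>.\<close>
  moreover have "nwords n // wker n S f \<subseteq> (\<lambda>s. {b \<in> nwords n. weval S f b = s}) ` elems S"
  proof
    fix C assume "C \<in> nwords n // wker n S f"
    then obtain a where a: "a \<in> nwords n" "C = wker n S f `` {a}" by (auto elim!: quotientE)
    then have "C = {b \<in> nwords n. weval S f b = weval S f a}" by (auto simp: wker_def)
    then show "C \<in> (\<lambda>s. {b \<in> nwords n. weval S f b = s}) ` elems S"
      using weval_in[OF S(1) assms(2) a(1)] by blast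
  qed
  then have "finite (nwords n // wker n S f)"
    using S(2) finite_surj by blast
  moreover have "\<forall>(a, b)\<in>wker n S f. \<forall>(c, d)\<in>wker n S f. (a @ c, b @ d) \<in> wker n S f"
    using weval_append[OF S(1) assms(2)] by (auto simp: wker_def nwords_append)
  ultimately show ?thesis unfolding fin_congs_def by blast
qed

lemma fin_congs_equiv: "r \<in> fin_congs n \<Longrightarrow> equiv (nwords n) r"
  by (simp add: fin_congs_def)

lemma fin_congs_append: "r \<in> fin_congs n \<Longrightarrow> (a, b) \<in> r \<Longrightarrow> (c, d) \<in> r \<Longrightarrow> (a @ c, b @ d) \<in> r"
  by (auto simp: fin_congs_def)

text \<open>Intersections serve to represent a profinite word by one finite word modulo several
  congruences at once.\<close>

lemma fin_congs_Int:
  assumes "r \<in> fin_congs n" "s \<in> fin_congs n"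
  shows "r \<inter> s \<in> fin_congs n"
proof -
  have eq: "equiv (nwords n) (r \<inter> s)"
    using fin_congs_equiv[OF assms(1)] fin_congs_equiv[OF assms(2)]
    by (auto intro!: equivI refl_onI sym_Int trans_Int elim!: equivE dest: refl_onD)
  have "nwords n // (r \<inter> s) \<subseteq> (\<lambda>(A, B). A \<inter> B) ` ((nwords n // r) \<times> (nwords n // s))"
  proof
    fix C assume "C \<in> nwords n // (r \<inter> s)"
    then obtain a where "a \<in> nwords n" "C = r `` {a} \<inter> s `` {a}" by (auto elim!: quotientE)
    then show "C \<in> (\<lambda>(A, B). A \<inter> B) ` ((nwords n // r) \<times> (nwords n // s))"
      by (auto intro!: image_eqI[of _ _ "(r `` {a}, s `` {a})"] quotientI)
  qed
  moreover have "finite ((nwords n // r) \<times> (nwords n // s))"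
    using assms by (simp add: fin_congs_def)
  ultimately have "finite (nwords n // (r \<inter> s))"
    using finite_surj by blast
  moreover have "\<forall>(a, b)\<in>r \<inter> s. \<forall>(c, d)\<in>r \<inter> s. (a @ c, b @ d) \<in> r \<inter> s"
    using fin_congs_append[OF assms(1)] fin_congs_append[OF assms(2)] by auto
  ultimately show ?thesis using eq unfolding fin_congs_def by blast
qed

lemma fin_congs_INT:
  assumes "finite R" "R \<subseteq> fin_congs n" "r \<in> fin_congs n"
  shows "r \<inter> \<Inter> R \<in> fin_congs n"
  using assms(1,2)
proof (induction R)
  case (insert s R)
  then have "s \<inter> (r \<inter> \<Inter> R) \<in> fin_congs n"
    using fin_congs_Int[of s n "r \<inter> \<Inter> R"] by auto
  moreover have "s \<inter> (r \<inter> \<Inter> R) = r \<inter> \<Inter> (insert s R)" by blast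
  ultimately show ?case by simp
qed (use assms in simp)

lemma free_profinite_class:
  "u \<in> elems (free_profinite n) \<Longrightarrow> r \<in> fin_congs n \<Longrightarrow> u r \<in> nwords n // r"
  by (auto simp: free_profinite_def)

lemma free_profinite_mono:
  "u \<in> elems (free_profinite n) \<Longrightarrow> r \<in> fin_congs n \<Longrightarrow> s \<in> fin_congs n \<Longrightarrow> r \<subseteq> s \<Longrightarrow> u r \<subseteq> u s"
  by (auto simp: free_profinite_def)

lemma free_profinite_ex:
  assumes "u \<in> elems (free_profinite n)" "r \<in> fin_congs n"
  obtains a where "a \<in> u r" "a \<in> nwords n"
  using free_profinite_class[OF assms] fin_congs_equiv[OF assms(2)]
  by (metis in_quotient_imp_non_empty in_quotient_imp_subset subset_empty subset_iff ex_in_conv)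

lemma free_profinite_class_eq:
  assumes "u \<in> elems (free_profinite n)" "r \<in> fin_congs n" "a \<in> u r"
  shows "u r = r `` {a}"
  using free_profinite_class[OF assms(1,2)] fin_congs_equiv[OF assms(2)] assms(3)
  by (metis Image_singleton_iff equiv_class_eq quotientE)

lemma free_profinite_wker:
  assumes "u \<in> elems (free_profinite n)" "wker n S f \<in> fin_congs n"
    "a \<in> u (wker n S f)" "b \<in> u (wker n S f)"
  shows "weval S f a = weval S f b"
  using free_profinite_class_eq[OF assms(1-3)] assms(4) by (auto simp: wker_def)

text \<open>The canonical map from the free semigroup into the free profinite semigroup. Its image
  is dense, so continuous homomorphisms are determined on it.\<close>

definition pword :: "nat \<Rightarrow> nat list \<Rightarrow> pro_word" where
  "pword n a = (\<lambda>r\<in>fin_congs n. r `` {a})"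

lemma pword_in: "a \<in> nwords n \<Longrightarrow> pword n a \<in> elems (free_profinite n)"
  by (auto simp: pword_def free_profinite_def quotientI)

lemma pword_append:
  assumes "a \<in> nwords n" "b \<in> nwords n"
  shows "pword n (a @ b) = mul (free_profinite n) (pword n a) (pword n b)"
proof -
  have "r `` {a @ b} = r `` {c @ d | c d. c \<in> r `` {a} \<and> d \<in> r `` {b}}" if r: "r \<in> fin_congs n" for r
  proof
    have "(a, a) \<in> r" "(b, b) \<in> r"
      using fin_congs_equiv[OF r] assms by (auto simp: equiv_def refl_on_def)
    then show "r `` {a @ b} \<subseteq> r `` {c @ d | c d. c \<in> r `` {a} \<and> d \<in> r `` {b}}" by blast
    have "trans r" using fin_congs_equiv[OF r] by (simp add: equiv_def)
    show "r `` {c @ d | c d. c \<in> r `` {a} \<and> d \<in> r `` {b}} \<subseteq> r `` {a @ b}"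
    proof
      fix e assume "e \<in> r `` {c @ d | c d. c \<in> r `` {a} \<and> d \<in> r `` {b}}"
      then obtain c d where "(a, c) \<in> r" "(b, d) \<in> r" "(c @ d, e) \<in> r" by blast
      then show "e \<in> r `` {a @ b}"
        using fin_congs_append[OF r] \<open>trans r\<close> by (blast dest: transD)
    qed
  qed
  then show ?thesis
    by (auto simp: pword_def free_profinite_def fun_eq_iff restrict_def)
qed

lemma topspace_profinite: "topspace (profinite_topology n) = elems (free_profinite n)"
  by (auto simp: profinite_topology_def free_profinite_def)

text \<open>On images of finite words, \<open>\<phi>\<close> is evaluation at \<open>f\<close>. By
  continuity the fibre of \<open>\<phi>\<close> through \<open>u\<close> is an open neighbourhood of
  \<open>u\<close>, so it contains the image of a finite word \<open>b\<close>, which can moreover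
  be chosen congruent to \<open>u\<close> modulo the kernel of \<open>f\<close>.\<close>

lemma cont_homs_weval:
  fixes S :: "'a sgrp"
  assumes S: "fin_semigrp S" and phi: "\<phi> \<in> cont_homs n S"
  defines "f \<equiv> \<lambda>k. \<phi> (pword n [k])"
  shows "f \<in> {..<n} \<rightarrow> elems S"
    and "u \<in> elems (free_profinite n) \<Longrightarrow> a \<in> u (wker n S f) \<Longrightarrow> \<phi> u = weval S f a"
proof -
  have hom: "\<phi> \<in> sgrp_hom (free_profinite n) S"
    and cont: "continuous_map (profinite_topology n) (discrete_topology (elems S)) \<phi>"
    using phi by (auto simp: cont_homs_def)
  show f: "f \<in> {..<n} \<rightarrow> elems S"
    using hom pword_in by (fastforce simp: f_def sgrp_hom_def nwords_iff)
  have ev: "\<phi> (pword n b) = weval S f b" if "b \<in> nwords n" for b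
    using that
  proof (induction rule: nwords_induct)
    case (single x)
    then show ?case by (simp add: f_def)
  next
    case (Cons x b)
    have x: "[x] \<in> nwords n" using Cons by (simp add: nwords_iff)
    have "\<phi> (pword n (x # b)) = mul S (\<phi> (pword n [x])) (\<phi> (pword n b))"
      using hom pword_append[OF x Cons(2)] pword_in[OF x] pword_in[OF Cons(2)]
      by (auto simp: sgrp_hom_def)
    then show ?case using Cons by (simp add: weval_Cons nwords_iff f_def)
  qed
  assume u: "u \<in> elems (free_profinite n)" and a: "a \<in> u (wker n S f)"
  have k: "wker n S f \<in> fin_congs n" using wker_fin_congs[OF S f] .
  have "\<phi> u \<in> elems S" using hom u by (auto simp: sgrp_hom_def)
  then have "openin (profinite_topology n) {v \<in> elems (free_profinite n). \<phi> v \<in> {\<phi> u}}"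
    using openin_continuous_map_preimage[OF cont, of "{\<phi> u}"] by (simp add: topspace_profinite)
  then obtain T where T: "openin (product_topology (\<lambda>r. discrete_topology (nwords n // r)) (fin_congs n)) T"
    and Teq: "{v \<in> elems (free_profinite n). \<phi> v \<in> {\<phi> u}} = T \<inter> elems (free_profinite n)"
    unfolding profinite_topology_def openin_subtopology by blast
  have "u \<in> T" using Teq u by blast
  then obtain U where U: "finite {r \<in> fin_congs n. U r \<noteq> nwords n // r}"
    "u \<in> Pi\<^sub>E (fin_congs n) U" "Pi\<^sub>E (fin_congs n) U \<subseteq> T"
    using T unfolding openin_product_topology_alt by force
  \<comment> \<open>A basic open set restricts only the finitely many coordinates in
    \<open>R\<close>. Adding the kernel of \<open>f\<close> to the intersection makes
    \<open>b\<close> comparable with the given representative \<open>a\<close>.\<close>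
  define R where "R = {r \<in> fin_congs n. U r \<noteq> nwords n // r}"
  define r where "r = wker n S f \<inter> \<Inter> R"
  have r: "r \<in> fin_congs n"
    unfolding r_def using U(1) k by (intro fin_congs_INT) (auto simp: R_def)
  obtain b where b: "b \<in> u r" "b \<in> nwords n" using free_profinite_ex[OF u r] .
  have "pword n b \<in> Pi\<^sub>E (fin_congs n) U"
  proof (rule PiE_I)
    fix s assume s: "s \<in> fin_congs n"
    show "pword n b s \<in> U s"
    proof (cases "s \<in> R")
      case True
      then have "r \<subseteq> s" by (auto simp: r_def)
      then have "b \<in> u s" using free_profinite_mono[OF u r s] b by blast
      then have "u s = s `` {b}" using free_profinite_class_eq[OF u s] by blast
      moreover have "u s \<in> U s" using U(2) s by auto
      ultimately show ?thesis using s by (simp add: pword_def)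
    next
      case False
      then show ?thesis using s b(2) by (auto simp: R_def pword_def quotientI)
    qed
  qed (simp add: pword_def)
  then have "pword n b \<in> T \<inter> elems (free_profinite n)" using U(3) pword_in[OF b(2)] by blast
  then have "\<phi> (pword n b) = \<phi> u" using Teq by blast
  moreover have "b \<in> u (wker n S f)"
    using free_profinite_mono[OF u r k] b by (auto simp: r_def)
  ultimately show "\<phi> u = weval S f a"
    using ev[OF b(2)] free_profinite_wker[OF u k _ a] by metis
qed

text \<open>The universal property: the extension reads only the coordinate at the kernel of
  \<open>f\<close>, and a map that factors through one discrete coordinate is continuous.\<close>

lemma cont_homs_extend:
  fixes S :: "'a sgrp"
  assumes S: "fin_semigrp S" and f: "f \<in> {..<n} \<rightarrow> elems S"
  obtains \<phi> where "\<phi> \<in> cont_homs n S"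
    "\<And>u a. u \<in> elems (free_profinite n) \<Longrightarrow> a \<in> u (wker n S f) \<Longrightarrow> \<phi> u = weval S f a"
proof
  define k where "k = wker n S f"
  define g where "g = (\<lambda>A. weval S f (SOME a. a \<in> A))"
  define \<phi> where "\<phi> = (\<lambda>u :: pro_word. g (u k))"
  have sg: "semigrp S" using S by (simp add: fin_semigrp_def)
  have k: "k \<in> fin_congs n" unfolding k_def using wker_fin_congs[OF S f] .
  show ev: "\<phi> u = weval S f a" if "u \<in> elems (free_profinite n)" "a \<in> u (wker n S f)" for u a
  proof -
    have "(SOME b. b \<in> u k) \<in> u (wker n S f)" using that(2) unfolding k_def by (rule someI)
    then show ?thesis
      unfolding \<phi>_def g_def
      using free_profinite_wker[OF that(1) k[unfolded k_def] _ that(2)] by blast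
  qed
  have gin: "g A \<in> elems S" if "A \<in> nwords n // k" for A
  proof -
    have "A \<noteq> {}" "A \<subseteq> nwords n"
      using in_quotient_imp_non_empty[OF fin_congs_equiv[OF k] that]
        in_quotient_imp_subset[OF fin_congs_equiv[OF k] that] .
    then have "(SOME a. a \<in> A) \<in> nwords n" using some_in_eq[of A] by blast
    then show ?thesis unfolding g_def by (rule weval_in[OF sg f])
  qed
  have "\<phi> (mul (free_profinite n) u v) = mul S (\<phi> u) (\<phi> v)"
    if u: "u \<in> elems (free_profinite n)" and v: "v \<in> elems (free_profinite n)" for u v
  proof -
    obtain a b where a: "a \<in> u k" "a \<in> nwords n" and b: "b \<in> v k" "b \<in> nwords n"
      using free_profinite_ex[OF u k] free_profinite_ex[OF v k] by metis
    have eq: "u k = pword n a k" "v k = pword n b k"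
      using free_profinite_class_eq[OF u k a(1)] free_profinite_class_eq[OF v k b(1)] k
      by (auto simp: pword_def)
    \<comment> \<open>The product at coordinate \<open>k\<close> depends only on the factors at
      \<open>k\<close>, where \<open>u\<close> and \<open>v\<close> agree with the finite words
      \<open>a\<close> and \<open>b\<close>.\<close>
    have "mul (free_profinite n) u v k = mul (free_profinite n) (pword n a) (pword n b) k"
      using k eq by (simp add: free_profinite_def)
    also have "\<dots> = pword n (a @ b) k" using pword_append[OF a(2) b(2)] by simp
    finally have "\<phi> (mul (free_profinite n) u v) = \<phi> (pword n (a @ b))" by (simp add: \<phi>_def)
    also have "\<dots> = weval S f (a @ b)"
    proof (rule ev)
      show ab: "pword n (a @ b) \<in> elems (free_profinite n)"
        by (intro pword_in nwords_append a b)
      show "a @ b \<in> pword n (a @ b) (wker n S f)"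
        using k a b nwords_append[OF a(2) b(2)] by (simp add: pword_def k_def wker_def)
    qed
    also have "\<dots> = mul S (\<phi> u) (\<phi> v)"
      using weval_append[OF sg f a(2) b(2)] ev[OF u] ev[OF v] a b by (simp add: k_def)
    finally show ?thesis .
  qed
  then have "\<phi> \<in> sgrp_hom (free_profinite n) S"
    using free_profinite_class[OF _ k] gin by (auto simp: sgrp_hom_def \<phi>_def)
  moreover have "continuous_map (profinite_topology n) (discrete_topology (nwords n // k)) (\<lambda>u. u k)"
    unfolding profinite_topology_def
    using continuous_map_product_projection[OF k, of "\<lambda>r. discrete_topology (nwords n // r)"]
    by (intro continuous_map_from_subtopology)
  then have "continuous_map (profinite_topology n) (discrete_topology (elems S)) (g \<circ> (\<lambda>u. u k))"
    by (rule continuous_map_compose) (use gin in auto)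
  ultimately show "\<phi> \<in> cont_homs n S" by (auto simp: cont_homs_def \<phi>_def comp_def)
qed

text \<open>With \<open>satisfiesI\<close> this reduces satisfaction to assignments of the variables
  and to finite words representing both sides modulo the kernel.\<close>

lemma satisfiesD:
  assumes "fin_semigrp S" "satisfies S (n, u, v)" "(n, u, v) \<in> pseudoidentities"
    "f \<in> {..<n} \<rightarrow> elems S" "a \<in> u (wker n S f)" "b \<in> v (wker n S f)"
  shows "weval S f a = weval S f b"
proof -
  obtain \<phi> where phi: "\<phi> \<in> cont_homs n S"
    "\<And>u a. u \<in> elems (free_profinite n) \<Longrightarrow> a \<in> u (wker n S f) \<Longrightarrow> \<phi> u = weval S f a"
    using cont_homs_extend[OF assms(1,4)] by blast
  then have "\<phi> u = \<phi> v" using assms(2) by (auto simp: satisfies_def)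
  then show ?thesis using phi(2) assms(3,5,6) by (auto simp: pseudoidentities_def)
qed

lemma satisfiesI:
  assumes "fin_semigrp S" "(n, u, v) \<in> pseudoidentities"
    and "\<And>f. f \<in> {..<n} \<rightarrow> elems S \<Longrightarrow>
      \<exists>a\<in>u (wker n S f). \<exists>b\<in>v (wker n S f). weval S f a = weval S f b"
  shows "satisfies S (n, u, v)"
  unfolding satisfies_def prod.case
proof
  fix \<phi> assume phi: "\<phi> \<in> cont_homs n S"
  note w = cont_homs_weval[OF assms(1) phi]
  show "\<phi> u = \<phi> v"
    using assms(3)[OF w(1)] w(2) assms(2) by (fastforce simp: pseudoidentities_def)
qed

text \<open>Composing a continuous homomorphism into \<open>S\<close> with \<open>h\<close> gives
  one into \<open>T\<close>, and injectivity then cancels \<open>h\<close>. This carries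
  satisfaction between isomorphic copies.\<close>

lemma satisfies_embed:
  assumes "satisfies T e" "h \<in> sgrp_hom S T" "inj_on h (elems S)" "e \<in> pseudoidentities"
  shows "satisfies S e"
proof -
  obtain n u v where e: "e = (n, u, v)" "u \<in> elems (free_profinite n)" "v \<in> elems (free_profinite n)"
    using assms(4) by (auto simp: pseudoidentities_def)
  have "\<phi> u = \<phi> v" if phi: "\<phi> \<in> cont_homs n S" for \<phi>
  proof -
    have "h \<circ> \<phi> \<in> sgrp_hom (free_profinite n) T"
      using phi assms(2) by (auto simp: cont_homs_def sgrp_hom_def image_subset_iff)
    moreover have "continuous_map (profinite_topology n) (discrete_topology (elems T)) (h \<circ> \<phi>)"
      using phi assms(2)
      by (intro continuous_map_compose[of _ "discrete_topology (elems S)"])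
        (auto simp: cont_homs_def sgrp_hom_def)
    ultimately have "h (\<phi> u) = h (\<phi> v)"
      using assms(1) by (auto simp: satisfies_def e(1) cont_homs_def)
    moreover have "\<phi> u \<in> elems S" "\<phi> v \<in> elems S"
      using phi e by (auto simp: cont_homs_def sgrp_hom_def)
    ultimately show ?thesis using assms(3) by (auto dest: inj_onD)
  qed
  then show ?thesis by (simp add: satisfies_def e(1))
qed

section \<open>The pseudovariety\<close>

text \<open>As \<open>sgrp_pow\<close> counts exponents from one, the index \<open>p - 1\<close>
  denotes the power y^p.\<close>

definition law :: "nat \<Rightarrow> 'a sgrp \<Rightarrow> bool" where
  "law p S \<longleftrightarrow> (\<forall>x\<in>elems S. \<forall>y\<in>elems S.
     mul S x (mul S (sgrp_pow S y (p - 1)) x) = mul S x (mul S x (sgrp_pow S y (p - 1))))"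

text \<open>Kept polymorphic because the truncations and factor semigroups below do not live on
  natural numbers.\<close>

definition nil_laws :: "'a sgrp \<Rightarrow> bool" where
  "nil_laws S \<longleftrightarrow> nil_sgrp S \<and> (\<forall>p. prime p \<longrightarrow> law p S)"

definition law_pv :: "nat sgrp set" where
  "law_pv = {S. fin_semigrp S \<and> nil_laws S}"

lemma sgrp_pow_in: "semigrp S \<Longrightarrow> x \<in> elems S \<Longrightarrow> sgrp_pow S x k \<in> elems S"
  by (induction k) (auto intro: semigrp_mul)

lemma sgrp_pow_hom:
  assumes "semigrp S" "h \<in> sgrp_hom S T" "x \<in> elems S"
  shows "h (sgrp_pow S x k) = sgrp_pow T (h x) k"
proof (induction k)
  case (Suc k)
  have "h (mul S (sgrp_pow S x k) x) = mul T (h (sgrp_pow S x k)) (h x)"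
    using assms(2,3) sgrp_pow_in[OF assms(1,3)] by (simp add: sgrp_hom_def)
  then show ?case using Suc by simp
qed simp

lemma sgrp_pow_cong: "mul T = mul S \<Longrightarrow> sgrp_pow T x k = sgrp_pow S x k"
  by (induction k) auto

lemma sgrp_pow_idem: "mul S z z = z \<Longrightarrow> sgrp_pow S z k = z"
  by (induction k) auto

lemma sgrp_pow_zero_mono:
  assumes "sgrp_pow S x k = z" "mul S z x = z" "k \<le> m"
  shows "sgrp_pow S x m = z"
  using assms(3)
proof (induction m rule: dec_induct)
  case base
  show ?case by (rule assms(1))
next
  case (step m)
  show ?case using step.IH assms(2) by simp
qed

section \<open>Closure under images, subsemigroups and products\<close>

lemma nil_laws_image:
  assumes "semigrp S" "nil_laws S" "h \<in> sgrp_hom S T" "h ` elems S = elems T"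
  shows "nil_laws T"
proof -
  have hm: "h (mul S x y) = mul T (h x) (h y)" if "x \<in> elems S" "y \<in> elems S" for x y
    using assms(3) that by (auto simp: sgrp_hom_def)
  have hp: "h (sgrp_pow S x k) = sgrp_pow T (h x) k" if "x \<in> elems S" for x k
    using sgrp_pow_hom[OF assms(1,3) that] .
  note in_S = semigrp_mul[OF assms(1)] sgrp_pow_in[OF assms(1)]
  obtain z where z: "z \<in> elems S" "\<forall>x\<in>elems S. mul S z x = z \<and> mul S x z = z"
    "\<forall>x\<in>elems S. \<exists>k. sgrp_pow S x k = z"
    using assms(2) by (auto simp: nil_laws_def nil_sgrp_def)
  have "nil_sgrp T"
    unfolding nil_sgrp_def assms(4)[symmetric] ball_simps bex_simps
    using z by (intro bexI[of _ z] conjI ballI) (metis hm, metis hm, metis hp)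
  moreover have "law p T" if "law p S" for p
    unfolding law_def assms(4)[symmetric] ball_simps
  proof (intro ballI)
    fix x y assume x: "x \<in> elems S" and y: "y \<in> elems S"
    let ?q = "sgrp_pow S y (p - 1)"
    have "h (mul S x (mul S ?q x)) = h (mul S x (mul S x ?q))"
      using that x y by (simp add: law_def)
    then show "mul T (h x) (mul T (sgrp_pow T (h y) (p - 1)) (h x)) =
        mul T (h x) (mul T (h x) (sgrp_pow T (h y) (p - 1)))"
      using x y in_S by (simp add: hm hp)
  qed
  ultimately show ?thesis using assms(2) by (auto simp: nil_laws_def)
qed

lemma nil_laws_sub:
  assumes "sub_sgrp T S" "nil_laws S"
  shows "nil_laws T"
proof -
  have T: "semigrp T" "elems T \<subseteq> elems S" "mul T = mul S" using assms(1) by (auto simp: sub_sgrp_def)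
  note pow = sgrp_pow_cong[OF T(3)]
  obtain z where z: "z \<in> elems S" "\<forall>x\<in>elems S. mul S z x = z \<and> mul S x z = z"
    "\<forall>x\<in>elems S. \<exists>k. sgrp_pow S x k = z"
    using assms(2) by (auto simp: nil_laws_def nil_sgrp_def)
  obtain x where "x \<in> elems T" using T(1) by (auto simp: semigrp_def)
  \<comment> \<open>The zero of \<open>S\<close> is a power of every element, hence lies in each
    subsemigroup.\<close>
  then have "z \<in> elems T" using sgrp_pow_in[OF T(1)] z(3) T(2) pow by (metis subsetD)
  then have "nil_sgrp T"
    unfolding nil_sgrp_def pow using z T(2,3) by (intro bexI[of _ z]) auto
  moreover have "law p T" if "law p S" for p
    using that T pow by (auto simp: law_def)
  ultimately show ?thesis using assms(2) by (auto simp: nil_laws_def)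
qed

lemma semigrp_prod:
  assumes "\<And>i. i \<in> I \<Longrightarrow> semigrp (S i)"
  shows "semigrp (prod_sgrp I S)"
proof -
  have "elems (S i) \<noteq> {}" if "i \<in> I" for i using assms[OF that] by (simp add: semigrp_def)
  moreover have "mul (S i) (x i) (y i) \<in> elems (S i)"
    if "i \<in> I" "x \<in> (\<Pi>\<^sub>E i\<in>I. elems (S i))" "y \<in> (\<Pi>\<^sub>E i\<in>I. elems (S i))" for i x y
    using that by (intro semigrp_mul assms) auto
  moreover have "mul (S i) (mul (S i) (x i) (y i)) (z i) = mul (S i) (x i) (mul (S i) (y i) (z i))"
    if "i \<in> I" "x \<in> (\<Pi>\<^sub>E i\<in>I. elems (S i))" "y \<in> (\<Pi>\<^sub>E i\<in>I. elems (S i))"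
      "z \<in> (\<Pi>\<^sub>E i\<in>I. elems (S i))" for i x y z
    using that by (intro semigrp_assoc assms) auto
  ultimately show ?thesis
    by (auto simp: semigrp_def prod_sgrp_def PiE_eq_empty_iff fun_eq_iff)
qed

lemma sgrp_pow_prod:
  assumes "x \<in> elems (prod_sgrp I S)"
  shows "sgrp_pow (prod_sgrp I S) x k = (\<lambda>i\<in>I. sgrp_pow (S i) (x i) k)"
proof (induction k)
  case 0
  show ?case using assms PiE_restrict[of x I "\<lambda>i. elems (S i)"] by (simp add: prod_sgrp_def)
next
  case (Suc k)
  have "mul (prod_sgrp I S) (\<lambda>i\<in>I. sgrp_pow (S i) (x i) k) x = (\<lambda>i\<in>I. sgrp_pow (S i) (x i) (Suc k))"
    by (auto simp: prod_sgrp_def)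
  then show ?case by (simp only: sgrp_pow.simps Suc)
qed

lemma nil_laws_prod:
  assumes "finite I" "\<And>i. i \<in> I \<Longrightarrow> semigrp (S i)" "\<And>i. i \<in> I \<Longrightarrow> nil_laws (S i)"
  shows "nil_laws (prod_sgrp I S)"
proof -
  let ?P = "prod_sgrp I S"
  have "\<forall>i\<in>I. \<exists>z. z \<in> elems (S i) \<and> (\<forall>x\<in>elems (S i). mul (S i) z x = z \<and> mul (S i) x z = z) \<and>
     (\<forall>x\<in>elems (S i). \<exists>k. sgrp_pow (S i) x k = z)"
  proof
    fix i assume "i \<in> I"
    then have "nil_sgrp (S i)" using assms(3) by (simp add: nil_laws_def)
    then show "\<exists>z. z \<in> elems (S i) \<and> (\<forall>x\<in>elems (S i). mul (S i) z x = z \<and> mul (S i) x z = z) \<and>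
       (\<forall>x\<in>elems (S i). \<exists>k. sgrp_pow (S i) x k = z)"
      unfolding nil_sgrp_def by blast
  qed
  then obtain z where z: "\<And>i. i \<in> I \<Longrightarrow> z i \<in> elems (S i)"
    "\<And>i x. i \<in> I \<Longrightarrow> x \<in> elems (S i) \<Longrightarrow> mul (S i) (z i) x = z i \<and> mul (S i) x (z i) = z i"
    "\<And>i x. i \<in> I \<Longrightarrow> x \<in> elems (S i) \<Longrightarrow> \<exists>k. sgrp_pow (S i) x k = z i"
    by metis
  have "\<exists>k. sgrp_pow ?P x k = restrict z I" if x: "x \<in> elems ?P" for x
  proof -
    have xi: "x i \<in> elems (S i)" if "i \<in> I" for i using x that by (auto simp: prod_sgrp_def)
    then have "\<forall>i\<in>I. \<exists>k. sgrp_pow (S i) (x i) k = z i" using z(3) by blast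
    then obtain k where k: "\<And>i. i \<in> I \<Longrightarrow> sgrp_pow (S i) (x i) (k i) = z i" by metis
    \<comment> \<open>The sum dominates every \<open>k i\<close>, which gives one exponent for all
      components.\<close>
    have "sgrp_pow (S i) (x i) (sum k I) = z i" if "i \<in> I" for i
      using sgrp_pow_zero_mono[OF k[OF that]] z(2)[OF that xi[OF that]] member_le_sum[OF that, of k] assms(1)
      by auto
    then show ?thesis by (intro exI[of _ "sum k I"]) (auto simp: sgrp_pow_prod[OF x])
  qed
  moreover have "restrict z I \<in> elems ?P" using z(1) by (auto simp: prod_sgrp_def)
  moreover have "mul ?P (restrict z I) x = restrict z I \<and> mul ?P x (restrict z I) = restrict z I"
    if "x \<in> elems ?P" for x
    using that z(2) by (auto simp: prod_sgrp_def fun_eq_iff PiE_mem)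
  ultimately have "nil_sgrp ?P" unfolding nil_sgrp_def by blast
  moreover have "law p ?P" if "prime p" for p
  proof -
    have l: "law p (S i)" if "i \<in> I" for i using assms(3)[OF that] \<open>prime p\<close> by (simp add: nil_laws_def)
    show ?thesis
      unfolding law_def
    proof (intro ballI)
      fix x y assume xy: "x \<in> elems ?P" "y \<in> elems ?P"
      have "x i \<in> elems (S i)" "y i \<in> elems (S i)" if "i \<in> I" for i
        using xy that by (auto simp: prod_sgrp_def)
      then show "mul ?P x (mul ?P (sgrp_pow ?P y (p - 1)) x) = mul ?P x (mul ?P x (sgrp_pow ?P y (p - 1)))"
        unfolding sgrp_pow_prod[OF xy(2)]
        using l by (auto simp: prod_sgrp_def law_def fun_eq_iff)
    qed
  qed
  ultimately show ?thesis by (simp add: nil_laws_def)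
qed

lemma pseudovariety_law_pv: "pseudovariety law_pv"
  unfolding pseudovariety_def
proof (intro conjI allI ballI impI; (elim conjE)?)
  fix S assume "S \<in> law_pv"
  then show "fin_semigrp S" by (simp add: law_pv_def)
next
  fix S T :: "nat sgrp" and h
  assume "S \<in> law_pv" "fin_semigrp T" "h \<in> sgrp_hom S T" "h ` elems S = elems T"
  then show "T \<in> law_pv" using nil_laws_image by (auto simp: law_pv_def fin_semigrp_def)
next
  fix S T :: "nat sgrp"
  assume "S \<in> law_pv" "sub_sgrp T S"
  then show "T \<in> law_pv"
    using nil_laws_sub by (auto simp: law_pv_def fin_semigrp_def sub_sgrp_def finite_subset)
next
  fix I :: "nat set" and S and T :: "nat sgrp" and h
  assume I: "finite I" "\<forall>i\<in>I. S i \<in> law_pv" and T: "fin_semigrp T" "h \<in> sgrp_iso (prod_sgrp I S) T"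
  have "semigrp (prod_sgrp I S)" "nil_laws (prod_sgrp I S)"
    using I by (auto simp: law_pv_def fin_semigrp_def intro!: semigrp_prod nil_laws_prod)
  then show "T \<in> law_pv"
    using T nil_laws_image by (auto simp: law_pv_def sgrp_iso_def bij_betw_def)
qed

section \<open>Rank at most two\<close>

lemma sgrp_span_subset:
  assumes "semigrp S" "A \<subseteq> elems S"
  shows "sgrp_span S A \<subseteq> elems S"
proof
  fix x assume "x \<in> sgrp_span S A"
  then show "x \<in> elems S" by induction (use assms in \<open>auto intro: semigrp_mul\<close>)
qed

lemma sgrp_span_cong:
  assumes "mul T = mul S"
  shows "sgrp_span T A = sgrp_span S A"
proof -
  have "x \<in> sgrp_span S A" if "x \<in> sgrp_span T A" for x
    using that by induction (auto simp: assms intro: sgrp_span.intros)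
  moreover have "x \<in> sgrp_span T A" if "x \<in> sgrp_span S A" for x
    using that by induction (auto simp: assms[symmetric] intro: sgrp_span.intros)
  ultimately show ?thesis by blast
qed

text \<open>An instance of a law takes place in the subsemigroup generated by its \<open>x\<close>
  and \<open>y\<close>. Only the existence of a common zero needs an argument.\<close>

lemma rank_law_pv: "rank_at_most law_pv 2"
  unfolding rank_at_most_def
proof (intro allI impI, elim conjE)
  fix S :: "nat sgrp"
  assume S: "fin_semigrp S" and sub: "\<forall>T. sub_sgrp T S \<and> n_generated 2 T \<longrightarrow> T \<in> law_pv"
  have sg: "semigrp S" using S by (simp add: fin_semigrp_def)
  define T where "T = (\<lambda>x y. \<lparr>elems = sgrp_span S {x, y}, mul = mul S\<rparr>)"
  have pow: "sgrp_pow (T x y) w k = sgrp_pow S w k" for x y w k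
    by (rule sgrp_pow_cong) (simp add: T_def)
  have xyT: "x \<in> elems (T x y)" "y \<in> elems (T x y)" for x y
    by (auto simp: T_def intro: sgrp_span.base)
  have T: "nil_laws (T x y)" "elems (T x y) \<subseteq> elems S" if xy: "x \<in> elems S" "y \<in> elems S" for x y
  proof -
    show TS: "elems (T x y) \<subseteq> elems S"
      using sgrp_span_subset[OF sg] xy by (simp add: T_def)
    have "semigrp (T x y)"
      unfolding semigrp_def
    proof (intro conjI ballI)
      show "elems (T x y) \<noteq> {}" using xyT by blast
      show "mul (T x y) a b \<in> elems (T x y)" if "a \<in> elems (T x y)" "b \<in> elems (T x y)" for a b
        using that by (auto simp: T_def intro: sgrp_span.mult)
      show "mul (T x y) (mul (T x y) a b) c = mul (T x y) a (mul (T x y) b c)"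
        if "a \<in> elems (T x y)" "b \<in> elems (T x y)" "c \<in> elems (T x y)" for a b c
        using that TS semigrp_assoc[OF sg] by (auto simp: T_def subset_iff)
    qed
    then have "sub_sgrp (T x y) S" using TS by (simp add: sub_sgrp_def T_def)
    moreover have "n_generated 2 (T x y)"
      unfolding n_generated_def
      using xyT sgrp_span_cong[of "T x y" S "{x, y}"]
      by (intro exI[of _ "{x, y}"]) (auto simp: T_def card_insert_if)
    ultimately show "nil_laws (T x y)" using sub by (auto simp: law_pv_def)
  qed
  have law: "law p S" if "prime p" for p
    unfolding law_def
  proof (intro ballI)
    fix x y assume "x \<in> elems S" "y \<in> elems S"
    then have "law p (T x y)" using T(1) that by (auto simp: nil_laws_def)
    then have "mul (T x y) x (mul (T x y) (sgrp_pow (T x y) y (p - 1)) x) =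
        mul (T x y) x (mul (T x y) x (sgrp_pow (T x y) y (p - 1)))"
      unfolding law_def using xyT by blast
    then show "mul S x (mul S (sgrp_pow S y (p - 1)) x) = mul S x (mul S x (sgrp_pow S y (p - 1)))"
      unfolding pow by (simp add: T_def)
  qed
  obtain x where x: "x \<in> elems S" using sg by (auto simp: semigrp_def)
  \<comment> \<open>The candidate for the zero of \<open>S\<close> is the zero of a subsemigroup
    generated by a single element.\<close>
  obtain z where z: "z \<in> elems (T x x)" "mul S z z = z"
    using T(1)[OF x x] by (auto simp: nil_laws_def nil_sgrp_def T_def)
  have zS: "z \<in> elems S" using z(1) T(2)[OF x x] by blast
  have "mul S z y = z \<and> mul S y z = z \<and> (\<exists>k. sgrp_pow S y k = z)" if y: "y \<in> elems S" for y
  proof -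
    obtain z' where z': "\<forall>w\<in>elems (T z y). mul (T z y) z' w = z' \<and> mul (T z y) w z' = z'"
      "\<forall>w\<in>elems (T z y). \<exists>k. sgrp_pow (T z y) w k = z'"
      using T(1)[OF zS y] by (auto simp: nil_laws_def nil_sgrp_def)
    \<comment> \<open>Some power of \<open>z\<close> is the zero of the subsemigroup generated by
      \<open>z\<close> and \<open>y\<close>, but all powers of the idempotent \<open>z\<close> are
      \<open>z\<close>.\<close>
    have "z' = z" using z'(2) xyT(1)[of z y] sgrp_pow_idem[OF z(2)] pow by metis
    then show ?thesis using z' xyT(2)[of y z] pow by (auto simp: T_def)
  qed
  then have "nil_sgrp S" using zS by (auto simp: nil_sgrp_def)
  then show "S \<in> law_pv" using S law by (auto simp: law_pv_def nil_laws_def)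
qed

section \<open>Independence of the carrier type\<close>

lemma nat_copy:
  assumes "fin_semigrp S"
  obtains T :: "nat sgrp" and h where "fin_semigrp T" "h \<in> sgrp_iso S T"
proof -
  obtain h where h: "bij_betw h (elems S) {0..<card (elems S)}"
    using ex_bij_betw_finite_nat assms by (auto simp: fin_semigrp_def)
  define g where "g = inv_into (elems S) h"
  have g: "g (h x) = x" if "x \<in> elems S" for x
    unfolding g_def using h that by (simp add: bij_betw_def)
  define T where "T = \<lparr>elems = h ` elems S, mul = (\<lambda>x y. h (mul S (g x) (g y)))\<rparr>"
  have sg: "semigrp S" and fin: "finite (elems S)" using assms by (auto simp: fin_semigrp_def)
  have "fin_semigrp T"
    using sg fin semigrp_mul[OF sg] semigrp_assoc[OF sg]
    by (auto simp: fin_semigrp_def semigrp_def T_def g)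
  moreover have "h \<in> sgrp_iso S T"
    using h by (auto simp: sgrp_iso_def sgrp_hom_def T_def g bij_betw_def)
  ultimately show ?thesis using that by blast
qed

text \<open>A basis is defined through semigroups on natural numbers. An isomorphic copy makes it
  usable for the semigroups constructed below.\<close>

lemma law_pv_basis:
  fixes S :: "'a sgrp"
  assumes "is_basis law_pv E" "fin_semigrp S"
  shows "nil_laws S \<longleftrightarrow> (\<forall>e\<in>E. satisfies S e)"
proof -
  obtain T :: "nat sgrp" and h where T: "fin_semigrp T" "h \<in> sgrp_iso S T"
    using nat_copy[OF assms(2)] .
  define g where "g = inv_into (elems S) h"
  have h: "h \<in> sgrp_hom S T" "inj_on h (elems S)" "h ` elems S = elems T"
    using T(2) by (auto simp: sgrp_iso_def bij_betw_def)
  have sg: "semigrp S" "semigrp T" using assms(2) T(1) by (auto simp: fin_semigrp_def)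
  have gh: "g (h x) = x" if "x \<in> elems S" for x
    unfolding g_def using h that by simp
  have g: "g \<in> sgrp_hom T S" "inj_on g (elems T)" "g ` elems T = elems S"
  proof -
    have "g (mul T (h x) (h y)) = mul S x y" if "x \<in> elems S" "y \<in> elems S" for x y
    proof -
      have "mul T (h x) (h y) = h (mul S x y)" using h(1) that by (auto simp: sgrp_hom_def)
      then show ?thesis using gh[OF semigrp_mul[OF sg(1) that]] by simp
    qed
    then show "g \<in> sgrp_hom T S" by (auto simp: sgrp_hom_def h(3)[symmetric] gh)
    show "inj_on g (elems T)" by (auto simp: h(3)[symmetric] gh inj_on_def)
    show "g ` elems T = elems S" by (auto simp: h(3)[symmetric] gh image_image)
  qed
  have E: "E \<subseteq> pseudoidentities" "T \<in> law_pv \<longleftrightarrow> (\<forall>e\<in>E. satisfies T e)"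
    using assms(1) T(1) by (auto simp: is_basis_def)
  have "nil_laws S \<longleftrightarrow> nil_laws T"
    using nil_laws_image[OF sg(1) _ h(1,3)] nil_laws_image[OF sg(2) _ g(1,3)] by blast
  also have "\<dots> \<longleftrightarrow> (\<forall>e\<in>E. satisfies T e)" using E(2) T(1) by (simp add: law_pv_def)
  also have "\<dots> \<longleftrightarrow> (\<forall>e\<in>E. satisfies S e)"
    using satisfies_embed[OF _ h(1,2)] satisfies_embed[OF _ g(1,2)] E(1) by blast
  finally show ?thesis .
qed

section \<open>Truncation by length\<close>

text \<open>The Rees quotient of the product of \<open>S\<close> with the additive semigroup of
  positive integers by the ideal of pairs with second component at least \<open>N\<close>. The
  collapsed ideal is the pair \<open>(z, N)\<close>, in which \<open>z\<close> is a mere label; its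
  second component \<open>N\<close> makes it absorbing without a clause of its own.\<close>

definition trunc :: "'a \<Rightarrow> nat \<Rightarrow> 'a sgrp \<Rightarrow> ('a \<times> nat) sgrp" where
  "trunc z N S = \<lparr>elems = insert (z, N) (elems S \<times> {1..<N}),
     mul = (\<lambda>(s, i) (t, j). if i + j < N then (mul S s t, i + j) else (z, N))\<rparr>"

lemma fin_semigrp_trunc:
  assumes "fin_semigrp S"
  shows "fin_semigrp (trunc z N S)"
proof -
  have sg: "semigrp S" and "finite (elems S)" using assms by (auto simp: fin_semigrp_def)
  then show ?thesis
    unfolding fin_semigrp_def semigrp_def[of "trunc z N S"]
    using semigrp_mul[OF sg] semigrp_assoc[OF sg] by (auto simp: trunc_def)
qed

text \<open>When every variable has second component 1, the second component of a value counts
  letters.\<close>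

lemma weval_trunc:
  assumes "a \<noteq> []" "N \<ge> 2"
  shows "weval (trunc z N S) (\<lambda>k. (f k, Suc 0)) a = (if length a < N then (weval S f a, length a) else (z, N))"
  using assms(1)
proof (induction a)
  case (Cons x a)
  then show ?case
    using assms(2) by (cases "a = []") (auto simp: weval_Cons trunc_def)
qed simp

text \<open>The case \<open>k = 0\<close> stands apart because for \<open>i = N\<close> the first
  power is \<open>(s, N)\<close> itself, whatever \<open>s\<close> is.\<close>

lemma sgrp_pow_trunc:
  assumes "i \<le> N"
  shows "sgrp_pow (trunc z N S) (s, i) k =
     (if k = 0 then (s, i) else if Suc k * i < N then (sgrp_pow S s k, Suc k * i) else (z, N))"
  by (induction k) (auto simp: trunc_def)

lemma nil_laws_trunc:
  assumes "\<And>p. prime p \<Longrightarrow> p < N \<Longrightarrow> law p S" "N \<ge> 1"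
  shows "nil_laws (trunc z N S)"
proof -
  let ?T = "trunc z N S"
  have pow: "\<exists>k. sgrp_pow ?T x k = (z, N)" if "x \<in> elems ?T" for x
  proof -
    obtain s i where x: "x = (s, i)" "1 \<le> i" "i \<le> N"
      using \<open>x \<in> elems ?T\<close> assms(2) by (auto simp: trunc_def)
    have "\<not> Suc N * i < N" using x(2) by (cases i) auto
    then have "sgrp_pow ?T x N = (z, N)"
      unfolding x(1) sgrp_pow_trunc[OF x(3)] using assms(2) by auto
    then show ?thesis ..
  qed
  have "nil_sgrp ?T"
    unfolding nil_sgrp_def
    by (intro bexI[of _ "(z, N)"] conjI ballI pow) (auto simp: trunc_def)
  moreover have "law p ?T" if p: "prime p" for p
    unfolding law_def
  proof (intro ballI)
    fix x y assume xy: "x \<in> elems ?T" "y \<in> elems ?T"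
    obtain s i t j where x: "x = (s, i)" "1 \<le> i" "i \<le> N" "i < N \<longrightarrow> s \<in> elems S"
      and y: "y = (t, j)" "1 \<le> j" "j \<le> N" "j < N \<longrightarrow> t \<in> elems S"
      using xy assms(2) by (auto simp: trunc_def)
    \<comment> \<open>A prime is at least 2, so \<open>p - 1\<close> is a successor and the case
      \<open>k = 0\<close> of \<open>sgrp_pow_trunc\<close> does not arise.\<close>
    obtain m where m: "p = Suc (Suc m)" using prime_ge_2_nat[OF p] by (metis add_2_eq_Suc le_Suc_ex)
    have pj: "p \<le> p * j" "i \<le> p * j + i" using y(2) by auto
    show "mul ?T x (mul ?T (sgrp_pow ?T y (p - 1)) x) = mul ?T x (mul ?T x (sgrp_pow ?T y (p - 1)))"
    \<comment> \<open>This is the total second component of either side. Below \<open>N\<close> it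
      forces \<open>p < N\<close>, since \<open>j\<close> is positive, and the law of
      \<open>S\<close> applies; otherwise both sides are zero.\<close>
    proof (cases "i + (p * j + i) < N")
      case True
      then have "j < N" "p < N" "i < N" using pj y(2) m by (auto simp: less_le_trans le_less_trans)
      then have "law p S" "s \<in> elems S" "t \<in> elems S" using assms(1) p x y by auto
      then have "mul S s (mul S (sgrp_pow S t (p - 1)) s) = mul S s (mul S s (sgrp_pow S t (p - 1)))"
        by (simp add: law_def)
      then show ?thesis
        using True unfolding x(1) y(1) sgrp_pow_trunc[OF y(3)] m by (auto simp: trunc_def algebra_simps)
    next
      case False
      then show ?thesis
        unfolding x(1) y(1) sgrp_pow_trunc[OF y(3)] m by (auto simp: trunc_def algebra_simps)
    qed
  qed
  ultimately show ?thesis by (simp add: nil_laws_def)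
qed

section \<open>The length of a profinite word\<close>

definition nilpotent_sgrp :: "'a sgrp \<Rightarrow> bool" where
  "nilpotent_sgrp S \<longleftrightarrow> (\<exists>z M. \<forall>n f a. f \<in> {..<n} \<rightarrow> elems S \<longrightarrow> a \<in> nwords n \<longrightarrow>
     M \<le> length a \<longrightarrow> weval S f a = z)"

text \<open>The monogenic nilpotent semigroup with \<open>N\<close> elements. Sending each letter to
  its generator 1 records lengths up to \<open>N\<close>, and \<open>len_cong\<close> is the kernel
  of this map, so it has finite index.\<close>

definition len_sgrp :: "nat \<Rightarrow> nat sgrp" where
  "len_sgrp N = \<lparr>elems = {1..N}, mul = (\<lambda>i j. min N (i + j))\<rparr>"

lemma fin_semigrp_len: "N \<ge> 1 \<Longrightarrow> fin_semigrp (len_sgrp N)"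
  by (auto simp: fin_semigrp_def semigrp_def len_sgrp_def)

lemma weval_len: "a \<noteq> [] \<Longrightarrow> N \<ge> 1 \<Longrightarrow> weval (len_sgrp N) (\<lambda>_. Suc 0) a = min N (length a)"
proof (induction a)
  case (Cons x a)
  then show ?case by (cases "a = []") (auto simp: weval_Cons len_sgrp_def)
qed simp

definition len_cong :: "nat \<Rightarrow> nat \<Rightarrow> nat list rel" where
  "len_cong n N = wker n (len_sgrp N) (\<lambda>_. Suc 0)"

lemma len_cong_fin_congs: "N \<ge> 1 \<Longrightarrow> len_cong n N \<in> fin_congs n"
  unfolding len_cong_def by (intro wker_fin_congs fin_semigrp_len) (auto simp: len_sgrp_def)

lemma len_cong_iff:
  "N \<ge> 1 \<Longrightarrow> (a, b) \<in> len_cong n N \<longleftrightarrow>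
    a \<in> nwords n \<and> b \<in> nwords n \<and> min N (length a) = min N (length b)"
  by (auto simp: len_cong_def wker_def weval_len nwords_iff)

text \<open>\<open>short n N u\<close> says that \<open>u\<close> is (the image of) a word of length less than \<open>N\<close>.\<close>

definition short :: "nat \<Rightarrow> nat \<Rightarrow> pro_word \<Rightarrow> bool" where
  "short n N u \<longleftrightarrow> N \<ge> 1 \<and> (\<exists>a\<in>u (len_cong n N). length a < N)"

text \<open>All words in the class of \<open>u\<close> modulo \<open>len_cong n N\<close> have the
  same length capped at \<open>N\<close>, so any representative decides.\<close>

lemma short_length:
  assumes "u \<in> elems (free_profinite n)" "N \<ge> 1" "a \<in> u (len_cong n N)"
  shows "length a < N \<longleftrightarrow> short n N u"
proof -
  have eq: "u (len_cong n N) = len_cong n N `` {b}" if "b \<in> u (len_cong n N)" for b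
    using free_profinite_class_eq[OF assms(1) len_cong_fin_congs[OF assms(2)] that] .
  have "length a < N \<longleftrightarrow> length b < N" if "b \<in> u (len_cong n N)" for b
  proof -
    have "(b, a) \<in> len_cong n N" using eq[OF that] assms(3) by blast
    then have "min N (length b) = min N (length a)" by (simp add: len_cong_iff[OF assms(2)])
    then show ?thesis by (simp add: min_def split: if_splits)
  qed
  then show ?thesis using assms(2,3) unfolding short_def by blast
qed

text \<open>Modulo the kernel of \<open>f\<close>, each side is represented by a word of length at
  least \<open>M\<close>, and all such words have the value \<open>z\<close>.\<close>

lemma satisfies_not_short:
  assumes "fin_semigrp S" "nilpotent_sgrp S" "(n, u, v) \<in> pseudoidentities"
    and "\<And>N. \<not> short n N u" "\<And>N. \<not> short n N v"
  shows "satisfies S (n, u, v)"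
proof (rule satisfiesI[OF assms(1,3)])
  fix f assume f: "f \<in> {..<n} \<rightarrow> elems S"
  obtain z M where M: "\<And>a. a \<in> nwords n \<Longrightarrow> M \<le> length a \<Longrightarrow> weval S f a = z"
    using assms(2) f unfolding nilpotent_sgrp_def by metis
  have k: "wker n S f \<in> fin_congs n" using wker_fin_congs[OF assms(1) f] .
  have l: "len_cong n (Suc M) \<in> fin_congs n" by (intro len_cong_fin_congs) simp
  have "\<exists>a\<in>w (wker n S f). weval S f a = z"
    if w: "w \<in> elems (free_profinite n)" "\<not> short n (Suc M) w" for w
  proof -
    obtain a where a: "a \<in> w (wker n S f \<inter> len_cong n (Suc M))" "a \<in> nwords n"
      using free_profinite_ex[OF w(1) fin_congs_Int[OF k l]] .
    then have "a \<in> w (wker n S f)" "a \<in> w (len_cong n (Suc M))"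
      using free_profinite_mono[OF w(1) fin_congs_Int[OF k l]] k l by blast+
    then show ?thesis using short_length[OF w(1), of "Suc M" a] w(2) M[OF a(2)] by auto
  qed
  note ex = this
  have "u \<in> elems (free_profinite n)" "v \<in> elems (free_profinite n)"
    using assms(3) by (auto simp: pseudoidentities_def)
  then obtain a b where "a \<in> u (wker n S f)" "weval S f a = z" "b \<in> v (wker n S f)" "weval S f b = z"
    using ex assms(4,5) by meson
  then show "\<exists>a\<in>u (wker n S f). \<exists>b\<in>v (wker n S f). weval S f a = weval S f b" by metis
qed

text \<open>Take finite words \<open>a\<close> and \<open>b\<close> for the two sides. Their values
  in the truncation agree, and one of the words is shorter than \<open>N\<close>, so this common
  value is not the zero. Hence both words are shorter than \<open>N\<close>, and the first
  components give equality in \<open>S\<close>.\<close>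

lemma satisfies_short:
  assumes S: "fin_semigrp S" and e: "(n, u, v) \<in> pseudoidentities"
    and short: "short n N u \<or> short n N v" and sat: "satisfies (trunc z N S) (n, u, v)"
  shows "satisfies S (n, u, v)"
proof (rule satisfiesI[OF S e])
  fix f assume f: "f \<in> {..<n} \<rightarrow> elems S"
  have u: "u \<in> elems (free_profinite n)" and v: "v \<in> elems (free_profinite n)"
    using e by (auto simp: pseudoidentities_def)
  have N1: "N \<ge> 1" using short by (auto simp: short_def)
  define T where "T = trunc z N S"
  define g where "g = (\<lambda>k. (f k, Suc 0))"
  have T: "fin_semigrp T" unfolding T_def using fin_semigrp_trunc[OF S] .
  have k: "wker n S f \<in> fin_congs n" using wker_fin_congs[OF S f] .
  have l: "len_cong n N \<in> fin_congs n" using len_cong_fin_congs[OF N1] .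
  \<comment> \<open>A nonempty word shorter than \<open>N\<close> exists; the bound puts the pairs
    \<open>(f k, Suc 0)\<close> into the truncation.\<close>
  have N2: "N \<ge> 2"
  proof -
    obtain a b where "a \<in> u (len_cong n N)" "a \<in> nwords n" "b \<in> v (len_cong n N)" "b \<in> nwords n"
      using free_profinite_ex[OF u l] free_profinite_ex[OF v l] by metis
    then have "length a < N \<or> length b < N" "length a \<ge> 1" "length b \<ge> 1"
      using short short_length[OF u N1] short_length[OF v N1] by (auto simp: nwords_iff Suc_le_eq)
    then show ?thesis by linarith
  qed
  have g: "g \<in> {..<n} \<rightarrow> elems T" using f N2 by (auto simp: T_def g_def trunc_def)
  have t: "wker n T g \<in> fin_congs n" using wker_fin_congs[OF T g] .
  \<comment> \<open>One representative per side must serve evaluation in \<open>S\<close>, length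
    and evaluation in the truncation simultaneously.\<close>
  define r where "r = wker n S f \<inter> (len_cong n N \<inter> wker n T g)"
  have r: "r \<in> fin_congs n" unfolding r_def by (intro fin_congs_Int k l t)
  obtain a b where a: "a \<in> u r" "a \<in> nwords n" and b: "b \<in> v r" "b \<in> nwords n"
    using free_profinite_ex[OF u r] free_profinite_ex[OF v r] by metis
  have sub: "r \<subseteq> wker n S f" "r \<subseteq> len_cong n N" "r \<subseteq> wker n T g" by (auto simp: r_def)
  note au = free_profinite_mono[OF u r, THEN subsetD, OF _ _ a(1)]
  note bv = free_profinite_mono[OF v r, THEN subsetD, OF _ _ b(1)]
  have "weval T g a = weval T g b"
    using satisfiesD[OF T _ e g au[OF t sub(3)] bv[OF t sub(3)]] sat by (simp add: T_def)
  moreover have "length a < N \<or> length b < N"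
    using short short_length[OF u N1 au[OF l sub(2)]] short_length[OF v N1 bv[OF l sub(2)]] by simp
  moreover have "a \<noteq> []" "b \<noteq> []" using a(2) b(2) by (auto simp: nwords_iff)
  ultimately have "weval S f a = weval S f b"
    unfolding T_def g_def using N2 by (auto simp: weval_trunc split: if_splits)
  then show "\<exists>a\<in>u (wker n S f). \<exists>b\<in>v (wker n S f). weval S f a = weval S f b"
    using au[OF k sub(1)] bv[OF k sub(1)] by blast
qed

section \<open>The semigroup of factors of a word\<close>

text \<open>The empty list plays the role of the zero.\<close>

definition factor_sgrp :: "'a list \<Rightarrow> 'a list sgrp" where
  "factor_sgrp w = \<lparr>elems = {x. sublist x w},
     mul = (\<lambda>x y. if x \<noteq> [] \<and> y \<noteq> [] \<and> sublist (x @ y) w then x @ y else [])\<rparr>"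

lemma mul_factor_Nil [simp]: "mul (factor_sgrp w) [] x = []" "mul (factor_sgrp w) x [] = []"
  by (simp_all add: factor_sgrp_def)

lemma sublist_appendD:
  assumes "sublist (x @ y) w"
  shows "sublist x w \<and> sublist y w"
proof -
  obtain P R where "w = P @ (x @ y) @ R" using assms by (auto simp: sublist_def)
  then have "w = P @ x @ (y @ R)" "w = (P @ x) @ y @ R" by simp_all
  then show ?thesis unfolding sublist_def by blast
qed

lemma fin_semigrp_factor: "fin_semigrp (factor_sgrp w)"
proof -
  have "{x. sublist x w} = set (sublists w)" by auto
  then have "finite {x. sublist x w}" by (metis List.finite_set)
  moreover have "semigrp (factor_sgrp w)"
    unfolding semigrp_def
  proof (intro conjI ballI)
    show "elems (factor_sgrp w) \<noteq> {}" by (auto simp: factor_sgrp_def)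
    show "mul (factor_sgrp w) x y \<in> elems (factor_sgrp w)" for x y by (auto simp: factor_sgrp_def)
    show "mul (factor_sgrp w) (mul (factor_sgrp w) x y) z = mul (factor_sgrp w) x (mul (factor_sgrp w) y z)"
      for x y z
    proof (cases "x = [] \<or> y = [] \<or> z = []")
      case False
      \<comment> \<open>Both bracketings are therefore nonzero exactly when \<open>x @ y @ z\<close>
        is a factor of \<open>w\<close>.\<close>
      have "sublist (x @ y) w" "sublist (y @ z) w" if "sublist (x @ y @ z) w"
        using sublist_appendD[of "x @ y" z w] sublist_appendD[of x "y @ z" w] that by simp_all
      then show ?thesis using False by (auto simp: factor_sgrp_def)
    qed auto
  qed
  ultimately show ?thesis by (simp add: fin_semigrp_def factor_sgrp_def)
qed

text \<open>A nonzero product is a concatenation of nonempty words, so it has at least as many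
  letters as factors, while elements have at most \<open>length w\<close> letters.\<close>

lemma nilpotent_factor: "nilpotent_sgrp (factor_sgrp w)"
proof -
  have "weval (factor_sgrp w) f a = [] \<or> length a \<le> length (weval (factor_sgrp w) f a)"
    if "a \<in> nwords n" for n f a
    using that
  proof (induction rule: nwords_induct)
    case (single x)
    then show ?case by (cases "f x") auto
  next
    case (Cons x a)
    then have "a \<noteq> []" by (simp add: nwords_iff)
    show ?case
      unfolding weval_Cons[OF \<open>a \<noteq> []\<close>]
      using Cons(3) by (cases "f x") (auto simp: factor_sgrp_def)
  qed
  moreover have "length (weval (factor_sgrp w) f a) \<le> length w"
    if "f \<in> {..<n} \<rightarrow> elems (factor_sgrp w)" "a \<in> nwords n" for n f a
    using weval_in[OF _ that] fin_semigrp_factor[of w]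
    by (auto simp: fin_semigrp_def factor_sgrp_def dest: sublist_length_le)
  ultimately show ?thesis
    unfolding nilpotent_sgrp_def
    by (intro exI[of _ "[]"] exI[of _ "Suc (length w)"]) (metis Suc_n_not_le_n le_trans)
qed

lemma sgrp_pow_factor:
  assumes "y \<noteq> []" "sublist y w"
  shows "sgrp_pow (factor_sgrp w) y k =
    (if sublist (concat (replicate (Suc k) y)) w then concat (replicate (Suc k) y) else [])"
proof (induction k)
  case (Suc k)
  define q where "q = concat (replicate (Suc k) y)"
  \<comment> \<open>\<open>sgrp_pow\<close> multiplies on the right, whereas
    \<open>replicate\<close> unfolds on the left.\<close>
  have "concat (replicate m y) @ y = y @ concat (replicate m y)" for m by (induction m) auto
  then have "concat (replicate (Suc (Suc k)) y) = q @ y" unfolding q_def by simp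
  moreover have "q \<noteq> []" using assms(1) by (simp add: q_def)
  moreover have "sgrp_pow (factor_sgrp w) y (Suc k) =
      mul (factor_sgrp w) (if sublist q w then q else []) y"
    using Suc by (simp add: q_def)
  ultimately show ?case
    using assms(1) sublist_appendD[of q y w] by (auto simp: factor_sgrp_def)
qed (use assms in simp)

text \<open>The word a b^p a, with 0 for a and 1 for b.\<close>

definition zword :: "nat \<Rightarrow> nat list" where
  "zword p = 0 # replicate p 1 @ [0]"

lemma count_zword: "count_list (zword p) 0 = 2"
  by (induction p) (auto simp: zword_def)

lemma count_concat_replicate: "count_list (concat (replicate k y)) c = k * count_list y c"
  by (induction k) auto

text \<open>The word has only two zeros, at its ends. A zero in \<open>y\<close> would occur at
  least twice in \<open>Q\<close> and leave none for the first letter of the word. A zero in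
  \<open>x\<close> would occur in both copies of \<open>x\<close>, so that \<open>F\<close> is the
  whole word; then \<open>x\<close> is \<open>[0]\<close> and \<open>Q\<close> is the block of ones,
  whose length \<open>p\<close> would be a multiple of \<open>q\<close>.\<close>

lemma zword_factor_zero_free:
  assumes q: "q \<ge> 2" "\<not> q dvd p" and ne: "x \<noteq> []" "y \<noteq> []"
    and Q: "Q = concat (replicate q y)"
    and F: "F = x @ Q @ x \<or> F = x @ x @ Q" and sub: "sublist F (zword p)"
  shows "count_list x 0 = 0" "count_list y 0 = 0"
proof -
  obtain P R where w: "zword p = P @ F @ R" using sub by (auto simp: sublist_def)
  have Qne: "Q \<noteq> []" using Q ne q(1) by (cases q) auto
  have cnt: "count_list P 0 + 2 * count_list x 0 + q * count_list y 0 + count_list R 0 = 2"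
    using count_zword[of p] F unfolding w Q by (auto simp: count_concat_replicate)
  have hd: "hd (zword p) = 0" and last: "last (zword p) = 0" by (simp_all add: zword_def)
  have pos: "count_list v 0 \<ge> 1" if "0 \<in> set v" for v :: "nat list"
    using that count_list_0_iff[of v 0] by linarith
  show y0: "count_list y 0 = 0"
  proof (rule ccontr)
    assume "count_list y 0 \<noteq> 0"
    then have "q * count_list y 0 \<ge> 2" using q(1) mult_le_mono[of 2 q 1 "count_list y 0"] by linarith
    then have "count_list (P @ x) 0 = 0" using cnt by simp
    \<comment> \<open>Both forms of \<open>F\<close> begin with \<open>x\<close>, so the initial
      zero lies in \<open>P @ x\<close>.\<close>
    moreover have "hd (zword p) = hd (P @ x)" using F ne unfolding w by (cases P) auto
    then have "0 \<in> set (P @ x)" using hd ne by (metis append_is_Nil_conv hd_in_set)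
    ultimately show False using pos by fastforce
  qed
  show "count_list x 0 = 0"
  proof (rule ccontr)
    assume "count_list x 0 \<noteq> 0"
    then have x1: "count_list x 0 = 1" and P0: "count_list P 0 = 0" and R0: "count_list R 0 = 0"
      using cnt by auto
    have "P = []"
    proof (rule ccontr)
      assume "P \<noteq> []"
      then have "0 \<in> set P" using hd unfolding w by (metis hd_append hd_in_set)
      then show False using pos P0 by fastforce
    qed
    have "R = []"
    proof (rule ccontr)
      assume "R \<noteq> []"
      then have "0 \<in> set R" using last unfolding w by (metis append_assoc last_appendR last_in_set)
      then show False using pos R0 by fastforce
    qed
    have wF: "zword p = F" using w \<open>P = []\<close> \<open>R = []\<close> by simp
    have Q0: "0 \<notin> set Q" using y0 pos[of y] by (auto simp: Q)
    \<comment> \<open>In the other form the word would end with the last letter of \<open>Q\<close>,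
      which is not 0.\<close>
    have FX: "F = x @ Q @ x"
    proof (rule ccontr)
      assume "F \<noteq> x @ Q @ x"
      then have "last (zword p) = last Q" using F wF Qne by auto
      then show False using last Q0 Qne by (metis last_in_set)
    qed
    obtain x' where x': "x = 0 # x'" using FX wF ne(1) by (cases x) (auto simp: zword_def)
    have "last x = 0" using last wF FX ne(1) by simp
    moreover have "0 \<notin> set x'" using x1 x' pos[of x'] by auto
    ultimately have "x = [0]" using x' by (metis last.simps last_in_set)
    then have "length Q = p" using arg_cong[OF wF, of length] FX by (simp add: zword_def)
    moreover have "length Q = q * length y" unfolding Q by (induction q) auto
    ultimately show False using q(2) by auto
  qed
qed

lemma law_factor:
  assumes q: "q \<ge> 2" "\<not> q dvd p"
  shows "law q (factor_sgrp (zword p))"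
  unfolding law_def
proof (intro ballI)
  let ?S = "factor_sgrp (zword p)"
  fix x y assume xy: "x \<in> elems ?S" "y \<in> elems ?S"
  show "mul ?S x (mul ?S (sgrp_pow ?S y (q - 1)) x) = mul ?S x (mul ?S x (sgrp_pow ?S y (q - 1)))"
  proof (cases "x = [] \<or> y = []")
    case True
    have "sgrp_pow ?S [] k = []" for k by (induction k) auto
    then show ?thesis using True by auto
  next
    case False
    define Q where "Q = concat (replicate q y)"
    have sub: "sublist x (zword p)" "sublist y (zword p)" using xy by (auto simp: factor_sgrp_def)
    have Qne: "Q \<noteq> []" using False q(1) by (cases q) (auto simp: Q_def)
    have "Suc (q - 1) = q" using q(1) by simp
    then have pow: "sgrp_pow ?S y (q - 1) = (if sublist Q (zword p) then Q else [])"
      using sgrp_pow_factor[of y "zword p" "q - 1"] False sub by (simp add: Q_def)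
    \<comment> \<open>Parts of a factor are factors, so no intermediate product vanishes unless the
      whole one does.\<close>
    have lhs: "mul ?S x (mul ?S (sgrp_pow ?S y (q - 1)) x) =
        (if sublist (x @ Q @ x) (zword p) then x @ Q @ x else [])"
      unfolding pow using False Qne sublist_appendD[of x "Q @ x" "zword p"] sublist_appendD[of Q x "zword p"]
      by (auto simp: factor_sgrp_def)
    have rhs: "mul ?S x (mul ?S x (sgrp_pow ?S y (q - 1))) =
        (if sublist (x @ x @ Q) (zword p) then x @ x @ Q else [])"
      unfolding pow using False Qne sublist_appendD[of x "x @ Q" "zword p"] sublist_appendD[of x Q "zword p"]
      by (auto simp: factor_sgrp_def)
    \<comment> \<open>If either side is nonzero, \<open>x\<close> and \<open>Q\<close> consist of
      ones only and commute, so the two sides are the same word.\<close>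
    have "x @ Q = Q @ x" if "F = x @ Q @ x \<or> F = x @ x @ Q" "sublist F (zword p)" for F
    proof -
      have "count_list x 0 = 0" "count_list y 0 = 0"
        using zword_factor_zero_free[OF q _ _ Q_def that] False by auto
      moreover have "set x \<subseteq> {0, 1}" "set y \<subseteq> {0, 1}"
        using sub[THEN set_mono_sublist] by (auto simp: zword_def)
      ultimately have "set x \<subseteq> {1}" "set Q \<subseteq> {1}"
        by (auto simp: count_list_0_iff Q_def)
      then have "x = replicate (length x) 1" "Q = replicate (length Q) 1"
        by (metis replicate_eqI singletonD subsetD)+
      then show ?thesis by (metis add.commute replicate_add)
    qed
    then have "x @ Q @ x = x @ x @ Q" if "sublist (x @ Q @ x) (zword p) \<or> sublist (x @ x @ Q) (zword p)"
      using that by (metis append_assoc)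
    then show ?thesis unfolding lhs rhs by (metis (full_types))
  qed
qed

text \<open>At \<open>x = [0]\<close> and \<open>y = [1]\<close> the left side is the whole word.
  The concatenation for the right side has the same length but ends in 1, so it is no factor and the
  right side is zero.\<close>

lemma not_law_factor:
  assumes "p \<ge> 1"
  shows "\<not> law p (factor_sgrp (zword p))"
proof
  let ?S = "factor_sgrp (zword p)"
  assume "law p ?S"
  have rep: "concat (replicate k [1]) = replicate k (1::nat)" for k by (induction k) auto
  have w: "zword p = [0] @ replicate p 1 @ [0]" by (simp add: zword_def)
  have subs: "sublist ([0] @ replicate p 1 @ [0]) (zword p)" by (simp add: w)
  have s0: "sublist [0] (zword p)" and s1: "sublist (replicate p 1) (zword p)"
    and s10: "sublist (replicate p 1 @ [0]) (zword p)"
    using sublist_appendD[OF subs] sublist_appendD[of "replicate p 1" "[0]" "zword p"] by auto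
  have "replicate p 1 = [1] @ replicate (p - 1) (1::nat)" using assms by (cases p) auto
  then have s1': "sublist [1] (zword p)"
    using sublist_appendD[of "[1]" "replicate (p - 1) 1" "zword p"] s1 by simp
  have "Suc (p - 1) = p" using assms by simp
  then have pow: "sgrp_pow ?S [1] (p - 1) = replicate p 1"
    using sgrp_pow_factor[of "[1]" "zword p" "p - 1"] s1 s1' unfolding rep by simp
  have "mul ?S [0] (mul ?S (replicate p 1) [0]) = zword p"
    using assms s10 subs w by (auto simp: factor_sgrp_def)
  moreover have "\<not> sublist ([0] @ [0] @ replicate p 1) (zword p)"
  proof
    assume "sublist ([0] @ [0] @ replicate p 1) (zword p)"
    then obtain P R where e: "zword p = P @ ([0] @ [0] @ replicate p 1) @ R" by (auto simp: sublist_def)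
    have "P = [] \<and> R = []" using arg_cong[OF e, of length] by (simp add: zword_def)
    then have "last (zword p) = 1" using e assms by simp
    then show False by (simp add: zword_def)
  qed
  then have "mul ?S [0] (mul ?S [0] (replicate p 1)) = []"
    by (auto simp: factor_sgrp_def)
  moreover have "[0] \<in> elems ?S" "[1] \<in> elems ?S" using s0 s1' by (auto simp: factor_sgrp_def)
  ultimately show False using \<open>law p ?S\<close> pow by (fastforce simp: law_def zword_def)
qed

section \<open>No finite basis\<close>

lemma infinitely_based_law_pv: "infinitely_based law_pv"
  unfolding infinitely_based_def finitely_based_def
proof
  assume "\<exists>E. finite E \<and> is_basis law_pv E"
  then obtain E where E: "finite E" "is_basis law_pv E" by blast
  have ps: "E \<subseteq> pseudoidentities" using E(2) by (simp add: is_basis_def)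
  \<comment> \<open>The implication inside the existential lets one function \<open>N\<close> be
    chosen on all of \<open>E\<close>; its value matters only when some side is a finite
    word.\<close>
  have "\<forall>e\<in>E. \<exists>N. (\<exists>M. case e of (n, u, v) \<Rightarrow> short n M u \<or> short n M v) \<longrightarrow>
      (case e of (n, u, v) \<Rightarrow> short n N u \<or> short n N v)" by blast
  then obtain N where N: "\<And>n u v M. (n, u, v) \<in> E \<Longrightarrow> short n M u \<or> short n M v \<Longrightarrow>
      short n (N (n, u, v)) u \<or> short n (N (n, u, v)) v"
    by (fastforce dest!: bchoice)
  \<comment> \<open>The sum exceeds no single \<open>N e\<close> from below, so every truncation
    length in use is smaller than \<open>p\<close>.\<close>
  obtain p where p: "prime p" "sum N E < p" using bigger_prime by blast
  let ?S = "factor_sgrp (zword p)"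
  have laws: "law q ?S" if "prime q" "q < p" for q
  proof (rule law_factor)
    show "q \<ge> 2" using that(1) by (rule prime_ge_2_nat)
    show "\<not> q dvd p" using that p(1) by (metis less_irrefl primes_dvd_imp_eq)
  qed
  have "satisfies ?S e" if e: "e \<in> E" for e
  proof -
    obtain n u v where nuv: "e = (n, u, v)" by (cases e)
    show ?thesis
    proof (cases "\<exists>M. short n M u \<or> short n M v")
      case True
      define K where "K = N e"
      have sh: "short n K u \<or> short n K v" using True N e unfolding K_def nuv by blast
      have "K < p" using member_le_sum[OF e, of N] E(1) p(2) by (auto simp: K_def)
      moreover have "K \<ge> 1" using sh by (auto simp: short_def)
      \<comment> \<open>Only the laws for primes below \<open>K\<close> have to hold in
        \<open>?S\<close>, and the violated one is for \<open>p > K\<close>.\<close>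
      ultimately have "nil_laws (trunc [] K ?S)" using laws by (intro nil_laws_trunc) auto
      then have "satisfies (trunc [] K ?S) e"
        using law_pv_basis[OF E(2) fin_semigrp_trunc[OF fin_semigrp_factor]] e by blast
      then show ?thesis
        using satisfies_short[OF fin_semigrp_factor _ sh] e ps unfolding nuv by blast
    next
      case False
      then show ?thesis
        using satisfies_not_short[OF fin_semigrp_factor nilpotent_factor] e ps unfolding nuv by blast
    qed
  qed
  \<comment> \<open>Satisfying the whole supposed basis, \<open>?S\<close> would obey every law,
    including the one for \<open>p\<close>.\<close>
  then have "nil_laws ?S" using law_pv_basis[OF E(2) fin_semigrp_factor] by blast
  then show False using not_law_factor p(1) prime_ge_1_nat by (auto simp: nil_laws_def)
qed

theorem corollary3:
  shows "\<exists>V :: nat sgrp set. pseudovariety V \<and> (\<forall>S\<in>V. nil_sgrp S) \<and>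
    finite_rank V \<and> infinitely_based V"
  using pseudovariety_law_pv rank_law_pv infinitely_based_law_pv
  by (auto simp: finite_rank_def law_pv_def nil_laws_def intro!: exI[of _ law_pv])

end
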